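(* For every integer $d\ge2$ there are constants $C,c>0$, depending only on $d$, such that for every integer $N\ge2$ there is a set $\mathcal P_N\subset[0,1]^d$ of exactly $N$ points whose discrepancy function $D_N$ satisfies $$\|D_N\|_1\le C(\log N)^{(d-1)/2}\qquad\text{and}\qquad\|D_N\|_2\ge c\,N^{1/4}.$$
   Context: For a set $\mathcal P_N\subset[0,1]^d$ of cardinality $N$, its discrepancy function is $$D_N(x)=\sharp(\mathcal P_N\cap[0,x))-N\,|[0,x)|,\qquad x=(x_1,\dots,x_d)\in[0,1]^d,$$ where $[0,x)=\prod_{j=1}^d[0,x_j)$ and $|\cdot|$ is $d$-dimensional Lebesgue measure. $\|\cdot\|_p$ denotes the norm of $L^p([0,1]^d)$ with respect to Lebesgue measure. *)

theory Defs
  imports "HOL-Analysis.Analysis"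
begin

(* R^d is the space of extensional functions on {..<d}, so that the dimension d is an
   ordinary natural number over which a statement can quantify. *)

abbreviation lborel_pow :: "nat \<Rightarrow> (nat \<Rightarrow> real) measure" where
  "lborel_pow d \<equiv> Pi\<^sub>M {..<d} (\<lambda>_. lborel)"

definition unit_cube :: "nat \<Rightarrow> (nat \<Rightarrow> real) set" where
  "unit_cube d = (\<Pi>\<^sub>E j\<in>{..<d}. {0..1})"

definition anchored_box :: "nat \<Rightarrow> (nat \<Rightarrow> real) \<Rightarrow> (nat \<Rightarrow> real) set" where
  "anchored_box d x = (\<Pi>\<^sub>E j\<in>{..<d}. {0..<x j})"

definition discrepancy :: "nat \<Rightarrow> (nat \<Rightarrow> real) set \<Rightarrow> (nat \<Rightarrow> real) \<Rightarrow> real" where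
  "discrepancy d P x =
     real (card (P \<inter> anchored_box d x)) - real (card P) * measure (lborel_pow d) (anchored_box d x)"

(* A Bochner integral is 0 by convention when the integrand is not integrable; the lemma
   integrable_discrepancy_powr below excludes this for the discrepancy function. *)
definition Lp_norm :: "nat \<Rightarrow> real \<Rightarrow> ((nat \<Rightarrow> real) \<Rightarrow> real) \<Rightarrow> real" where
  "Lp_norm d p f = (LINT x:unit_cube d|lborel_pow d. \<bar>f x\<bar> powr p) powr (1 / p)"

lemma emeasure_anchored_box:
  assumes "x \<in> unit_cube d"
  shows "emeasure (lborel_pow d) (anchored_box d x) = ennreal (\<Prod>j<d. x j)"
proof -
  interpret product_sigma_finite "\<lambda>_::nat. lborel :: real measure" ..
  have x: "0 \<le> x j" if "j < d" for j
    using assms that by (auto simp: unit_cube_def PiE_iff)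
  have "emeasure (lborel_pow d) (anchored_box d x) = (\<Prod>j<d. emeasure lborel {0..<x j})"
    unfolding anchored_box_def by (rule emeasure_PiM) auto
  also have "\<dots> = (\<Prod>j<d. ennreal (x j))"
    using x by (intro prod.cong) auto
  also have "\<dots> = ennreal (\<Prod>j<d. x j)"
    using x by (intro prod_ennreal) auto
  finally show ?thesis .
qed

lemma measure_anchored_box:
  assumes "x \<in> unit_cube d"
  shows "measure (lborel_pow d) (anchored_box d x) = (\<Prod>j<d. x j)"
proof -
  have "0 \<le> (\<Prod>j<d. x j)"
    using assms by (intro prod_nonneg) (auto simp: unit_cube_def PiE_iff)
  then show ?thesis
    by (simp add: measure_def emeasure_anchored_box[OF assms])
qed

lemma sets_unit_cube: "unit_cube d \<in> sets (lborel_pow d)"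
  unfolding unit_cube_def by (rule sets_PiM_I_finite) auto

lemma emeasure_unit_cube: "emeasure (lborel_pow d) (unit_cube d) = 1"
proof -
  interpret product_sigma_finite "\<lambda>_::nat. lborel :: real measure" ..
  show ?thesis unfolding unit_cube_def by (subst emeasure_PiM) auto
qed

lemma discrepancy_eq:
  assumes "finite P" "P \<subseteq> unit_cube d" "x \<in> unit_cube d"
  shows "discrepancy d P x =
    (\<Sum>q\<in>P. \<Prod>j<d. if q j < x j then 1 else 0) - real (card P) * (\<Prod>j<d. x j)"
proof -
  have "(\<Prod>j<d. if q j < x j then 1 else 0) = (indicator (anchored_box d x) q :: real)"
    if "q \<in> P" for q
  proof -
    have "q \<in> unit_cube d" using that assms by auto
    then have "q \<in> anchored_box d x \<longleftrightarrow> (\<forall>j<d. q j < x j)"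
      by (auto simp: unit_cube_def anchored_box_def PiE_iff)
    then show ?thesis by (auto simp: indicator_def intro!: prod.neutral)
  qed
  then have "(\<Sum>q\<in>P. \<Prod>j<d. if q j < x j then 1 else 0) = real (card (P \<inter> anchored_box d x))"
    using assms(1) by (simp add: indicator_def sum.If_cases Int_def)
  then show ?thesis by (simp add: discrepancy_def measure_anchored_box assms)
qed

lemma integrable_discrepancy_powr:
  assumes P: "finite P" "P \<subseteq> unit_cube d" and p: "0 \<le> p"
  shows "set_integrable (lborel_pow d) (unit_cube d) (\<lambda>x. \<bar>discrepancy d P x\<bar> powr p)"
proof -
  let ?g = "\<lambda>x::nat \<Rightarrow> real. (\<Sum>q\<in>P. \<Prod>j<d. if q j < x j then 1 else 0) - real (card P) * (\<Prod>j<d. x j)"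
  have meas: "?g \<in> borel_measurable (lborel_pow d)"
    by measurable
  have bound: "\<bar>discrepancy d P x\<bar> \<le> real (card P)" if x: "x \<in> unit_cube d" for x
  proof -
    have 1: "card (P \<inter> anchored_box d x) \<le> card P" using P by (intro card_mono) auto
    have "0 \<le> (\<Prod>j<d. x j)" "(\<Prod>j<d. x j) \<le> 1"
      using x by (auto simp: unit_cube_def PiE_iff intro!: prod_nonneg prod_le_1)
    then have "0 \<le> real (card P) * (\<Prod>j<d. x j)" "real (card P) * (\<Prod>j<d. x j) \<le> real (card P)"
      by (auto intro: mult_left_le)
    then show ?thesis using 1 unfolding discrepancy_def measure_anchored_box[OF x] by auto
  qed
  have "set_integrable (lborel_pow d) (unit_cube d) (\<lambda>x. \<bar>?g x\<bar> powr p)"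
    unfolding set_integrable_def
  proof (rule integrableI_bounded_set[where A = "unit_cube d" and B = "real (card P) powr p"])
    show "(\<lambda>x. indicat_real (unit_cube d) x *\<^sub>R \<bar>?g x\<bar> powr p) \<in> borel_measurable (lborel_pow d)"
      using meas sets_unit_cube by measurable
    show "AE x in lborel_pow d. x \<in> unit_cube d \<longrightarrow>
        norm (indicat_real (unit_cube d) x *\<^sub>R \<bar>?g x\<bar> powr p) \<le> real (card P) powr p"
    proof (intro AE_I2 impI)
      fix x assume x: "x \<in> unit_cube d"
      have "\<bar>?g x\<bar> powr p \<le> real (card P) powr p"
        using bound[OF x] p by (intro powr_mono2) (auto simp flip: discrepancy_eq[OF P x])
      then show "norm (indicat_real (unit_cube d) x *\<^sub>R \<bar>?g x\<bar> powr p) \<le> real (card P) powr p"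
        using x by simp
    qed
  qed (auto simp: sets_unit_cube emeasure_unit_cube)
  also have "?this \<longleftrightarrow> ?thesis"
    by (intro set_integrable_cong refl) (simp add: discrepancy_eq[OF P])
  finally show ?thesis .
qed

end

theory Submission
  imports Defs "HOL-Number_Theory.Cong"
begin

text \<open>
  Put \<open>s = d - 1\<close> and choose pairwise coprime bases \<open>b j\<close>. Start from the points whose first \<open>s\<close>
  coordinates are the radical inverses of \<open>T + n\<close>, truncated to \<open>h\<close> digits with \<open>2 ^ h \<ge> N\<close>, and
  whose last coordinate is \<open>n / N\<close>. In each coordinate the indicator of an anchored interval is a
  telescoping sum of martingale differences with respect to the residues modulo powers of \<open>b j\<close>.
  Multiplying out, the discrepancy of a box is a sum of fewer than \<open>(h + 1) ^ s\<close> functions of the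
  shift \<open>T\<close>; these are bounded by the product of the bases and orthogonal on average over \<open>T\<close>. Hence
  its mean square over \<open>T\<close> is \<open>O((log N) ^ s)\<close>, pointwise in the corner of the box, and some shift
  has the required \<open>L\<close>-1 norm.

  Now compress the last \<open>k\<close> points, \<open>k\<close> being about \<open>sqrt N\<close>, into the lower half of their slab
  \<open>[1 - k / N, 1]\<close>. The counting function changes by at most \<open>k\<close>, on a set of measure \<open>k / N\<close>, so the
  \<open>L\<close>-1 norm grows by at most 1. In the emptied half of the slab the discrepancy is affine in
  the last coordinate with slope of order \<open>- N\<close>, whatever the other points are, so the integral of
  its square is at least of order \<open>N\<^sup>2 (k / N)\<^sup>3\<close>, that is \<open>sqrt N\<close>.
\<close>

subsection \<open>Digit reversal\<close>

text \<open>The numerator over \<open>p ^ r\<close> of the radical inverse of \<open>n\<close>, cut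
  to \<open>r\<close> digits: the lowest digit of \<open>n\<close> becomes the leading one.\<close>

primrec digit_rev :: "nat \<Rightarrow> nat \<Rightarrow> nat \<Rightarrow> nat" where
  "digit_rev p 0 n = 0"
| "digit_rev p (Suc r) n = p * digit_rev p r n + n div p ^ r mod p"

lemma digit_rev_less:
  assumes "0 < p"
  shows "digit_rev p r n < p ^ r"
proof (induction r)
  case (Suc r)
  have "p * digit_rev p r n + n div p ^ r mod p < p * digit_rev p r n + p"
    using assms by simp
  also have "\<dots> = p * Suc (digit_rev p r n)"
    by simp
  also have "\<dots> \<le> p * p ^ r"
    using Suc by (intro mult_le_mono2) simp
  finally show ?case by simp
qed simp

text \<open>Each side says that the lowest \<open>r\<close> digits agree; induction splits off one
  digit by uniqueness of quotient and remainder. Residue classes modulo \<open>p ^ r\<close> thus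
  correspond to cells of length \<open>1 / p ^ r\<close>.\<close>

lemma digit_rev_eq_iff:
  assumes "0 < p"
  shows "digit_rev p r m = digit_rev p r n \<longleftrightarrow> m mod p ^ r = n mod p ^ r"
proof (induction r)
  case (Suc r)
  have 1: "a mod p ^ Suc r = p ^ r * (a div p ^ r mod p) + a mod p ^ r" for a
    using mod_mult2_eq[of a "p ^ r" p] by (simp add: mult.commute)
  have 2: "c * x + u = c * y + v \<longleftrightarrow> x = y \<and> u = v" if "u < c" "v < c" for c x y u v :: nat
  proof
    assume *: "c * x + u = c * y + v"
    have "(c * x + u) div c = x" "(c * y + v) div c = y" using that by auto
    with * show "x = y \<and> u = v" by auto
  qed auto
  have "digit_rev p (Suc r) m = digit_rev p (Suc r) n \<longleftrightarrow>
      digit_rev p r m = digit_rev p r n \<and> m div p ^ r mod p = n div p ^ r mod p"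
    using assms by (simp add: 2)
  also have "\<dots> \<longleftrightarrow> m mod p ^ Suc r = n mod p ^ Suc r"
    unfolding 1 Suc using assms by (subst 2) auto
  finally show ?case .
qed simp

section \<open>Martingale differences of interval indicators\<close>

definition clamp01 :: "real \<Rightarrow> real" where
  "clamp01 u = max 0 (min 1 u)"

lemma sum_clamp01:
  "(\<Sum>c<p. clamp01 (w - real c)) = max 0 (min (real p) w)"
  by (induction p) (auto simp: clamp01_def max_def min_def)

text \<open>The martingale property: the filled proportion of a cell is the mean over its
  \<open>p\<close> children.\<close>

lemma sum_clamp01_scaled:
  assumes "0 < p"
  shows "(\<Sum>c<p. clamp01 (real p * u - real c)) = real p * clamp01 u"
proof -
  have "max 0 (min (real p) (real p * u)) = real p * max 0 (min 1 u)"
    using assms by (auto simp: max_def min_def mult_le_0_iff zero_le_mult_iff)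
  then show ?thesis by (subst sum_clamp01) (simp add: clamp01_def)
qed

text \<open>The proportion of those \<open>m\<close> congruent to \<open>n\<close> modulo \<open>p ^ r\<close> whose radical inverse is below
  \<open>y\<close>; it is strictly between 0 and 1 for at most one residue class.\<close>

definition level :: "nat \<Rightarrow> real \<Rightarrow> nat \<Rightarrow> nat \<Rightarrow> real" where
  "level p y r n = clamp01 (y * real p ^ r - real (digit_rev p r n))"

text \<open>Index 0 carries the mean \<open>y\<close>, which is level 0 for \<open>y\<close> in the
  unit interval, so the terms up to \<open>h\<close> telescope to
  \<open>level p y h\<close>.\<close>

definition level_diff :: "nat \<Rightarrow> real \<Rightarrow> nat \<Rightarrow> nat \<Rightarrow> real" where
  "level_diff p y e n = (if e = 0 then y else level p y e n - level p y (e - 1) n)"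

lemma level_cong:
  assumes "0 < p" "m mod p ^ r = n mod p ^ r"
  shows "level p y r m = level p y r n"
  using assms digit_rev_eq_iff[of p r m n] by (simp add: level_def)

lemma level_diff_cong:
  assumes "0 < p" "m mod p ^ e = n mod p ^ e"
  shows "level_diff p y e m = level_diff p y e n"
proof -
  have "m mod p ^ (e - 1) = n mod p ^ (e - 1)"
  proof -
    have "p ^ (e - 1) dvd p ^ e" by (simp add: le_imp_power_dvd)
    then show ?thesis using assms(2) by (metis mod_mod_cancel)
  qed
  then show ?thesis
    using assms level_cong[of p m e n] level_cong[of p m "e - 1" n] by (simp add: level_diff_def)
qed

lemma clamp01_bounds: "0 \<le> clamp01 u" "clamp01 u \<le> 1"
  by (auto simp: clamp01_def)

lemma abs_level_diff_le:
  assumes "0 \<le> y" "y \<le> 1"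
  shows "\<bar>level_diff p y e n\<bar> \<le> 1"
proof (cases "e = 0")
  case False
  have "0 \<le> level p y r n \<and> level p y r n \<le> 1" for r
    by (simp add: level_def clamp01_bounds)
  from this[of e] this[of "e - 1"] False show ?thesis
    unfolding level_diff_def by (auto simp: abs_le_iff)
qed (use assms in \<open>simp add: level_diff_def\<close>)

lemma level_Suc:
  "level p y (Suc r) n =
     clamp01 (real p * (y * real p ^ r - real (digit_rev p r n)) - real (n div p ^ r mod p))"
  by (simp add: level_def algebra_simps)

text \<open>A cell entirely on one side of \<open>y\<close> has all its children on that side, and
  the difference vanishes. In the proof \<open>u\<close> is the position of \<open>y\<close>
  relative to the cell and \<open>c\<close> the number of the child.\<close>

lemma level_diff_Suc_nonzero:
  assumes "1 < p" "level_diff p y (Suc r) n \<noteq> 0"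
  shows "real (digit_rev p r n) < y * real p ^ r" "y * real p ^ r < real (digit_rev p r n) + 1"
proof -
  define u where "u = y * real p ^ r - real (digit_rev p r n)"
  define c where "c = n div p ^ r mod p"
  have c: "real c \<le> real p - 1" "0 \<le> real c"
  proof -
    have "c < p" using assms unfolding c_def by auto
    then show "real c \<le> real p - 1" by linarith
  qed simp
  have E: "level_diff p y (Suc r) n = clamp01 (real p * u - real c) - clamp01 u"
    by (simp add: level_diff_def level_Suc u_def c_def level_def[of p y r])
  have "0 < u"
  proof (rule ccontr)
    assume "\<not> 0 < u"
    then have "real p * u \<le> 0" "u \<le> 0" by (auto simp: mult_le_0_iff)
    then show False using assms(2) c unfolding E by (simp add: clamp01_def)
  qed
  moreover have "u < 1"
  proof (rule ccontr)
    assume "\<not> u < 1"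
    then have "real p * u \<ge> real p" "u \<ge> 1" using assms by auto
    moreover from this have "1 \<le> real p * u - real c" using c by linarith
    ultimately have "clamp01 (real p * u - real c) = 1" "clamp01 u = 1"
      by (auto simp only: clamp01_def min.absorb1 max.absorb2 zero_le_one)
    then show False using assms(2) unfolding E by simp
  qed
  ultimately show "real (digit_rev p r n) < y * real p ^ r"
    "y * real p ^ r < real (digit_rev p r n) + 1" by (auto simp: u_def)
qed

text \<open>Only one integer lies strictly within distance 1 below a non-integer, so both indices
  belong to the one cell cut by \<open>y\<close>. For \<open>e = 0\<close> the truncated subtraction
  gives modulus 1.\<close>

lemma level_diff_support:
  assumes "1 < p" "level_diff p y e m \<noteq> 0" "level_diff p y e n \<noteq> 0"
  shows "m mod p ^ (e - 1) = n mod p ^ (e - 1)"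
proof (cases e)
  case (Suc r)
  have "digit_rev p r m = digit_rev p r n"
    using level_diff_Suc_nonzero[of p y r m] level_diff_Suc_nonzero[of p y r n] assms
    unfolding Suc by linarith
  then show ?thesis using assms(1) Suc by (simp add: digit_rev_eq_iff)
qed simp

lemma bij_betw_mult_add_mod:
  fixes p c a :: nat
  assumes "0 < p" "coprime c p"
  shows "bij_betw (\<lambda>k. (a + k * c) mod p) {..<p} {..<p}"
proof -
  have "inj_on (\<lambda>k. (a + k * c) mod p) {..<p}"
  proof (rule inj_onI)
    fix k l assume kl: "k \<in> {..<p}" "l \<in> {..<p}" and eq: "(a + k * c) mod p = (a + l * c) mod p"
    have "[a + k * c = a + l * c] (mod p)" using eq by (simp add: cong_def)
    then have "[k * c = l * c] (mod p)" by (simp add: cong_add_lcancel_nat)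
    then have "[k = l] (mod p)" using assms(2) by (simp add: cong_mult_rcancel_nat)
    then show "k = l" using kl by (simp add: cong_def)
  qed
  moreover have "(\<lambda>k. (a + k * c) mod p) ` {..<p} \<subseteq> {..<p}" using assms by auto
  ultimately show ?thesis
    by (simp add: bij_betw_def endo_inj_surj)
qed

text \<open>Multiples of \<open>c * p ^ (e - 1)\<close> keep the lowest \<open>e - 1\<close> digits
  and, \<open>c\<close> being a unit modulo \<open>p\<close>, run the next digit through all its
  values. The sum is over all children of one cell. The factor \<open>c\<close> will absorb the
  moduli of the other coordinates.\<close>

lemma level_diff_shift_sum:
  assumes p: "1 < p" and e: "0 < e" and c: "coprime c p"
  shows "(\<Sum>k<p. level_diff p y e (n + k * (c * p ^ (e - 1)))) = 0"
proof -
  obtain r where r: "e = Suc r" using e by (cases e) auto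
  define u where "u = y * real p ^ r - real (digit_rev p r n)"
  have rev: "digit_rev p r (n + k * (c * p ^ r)) = digit_rev p r n" for k
  proof -
    have "(n + k * (c * p ^ r)) mod p ^ r = n mod p ^ r"
      using mod_mult_self1[of n "k * c" "p ^ r"] by (simp add: ac_simps)
    then show ?thesis using p by (simp add: digit_rev_eq_iff)
  qed
  have digit: "(n + k * (c * p ^ r)) div p ^ r = n div p ^ r + k * c" for k
    using p div_mult_self1[of "p ^ r" n "k * c"] by (simp add: ac_simps)
  have "(\<Sum>k<p. level_diff p y e (n + k * (c * p ^ (e - 1)))) =
      (\<Sum>k<p. clamp01 (real p * u - real ((n div p ^ r + k * c) mod p)) - clamp01 u)"
    by (simp add: level_diff_def r level_Suc level_def[of p y r] rev digit u_def)
  also have "\<dots> = (\<Sum>k<p. clamp01 (real p * u - real ((n div p ^ r + k * c) mod p))) - real p * clamp01 u"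
    by (simp add: sum_subtractf)
  also have "(\<Sum>k<p. clamp01 (real p * u - real ((n div p ^ r + k * c) mod p))) =
      (\<Sum>k<p. clamp01 (real p * u - real k))"
    using p c by (intro sum.reindex_bij_betw bij_betw_mult_add_mod) auto
  finally show ?thesis using p by (simp add: sum_clamp01_scaled)
qed

lemma sum_level_diff:
  assumes "0 \<le> y" "y \<le> 1"
  shows "(\<Sum>e\<le>h. level_diff p y e n) = level p y h n"
  by (induction h) (use assms in \<open>auto simp: level_diff_def level_def clamp01_def\<close>)

text \<open>For such \<open>y\<close> the argument of \<open>clamp01\<close> is an integer, so no
  cell is cut.\<close>

lemma level_top:
  assumes "y * real p ^ h = real Y"
  shows "level p y h n = of_bool (digit_rev p h n < Y)"
  using assms by (auto simp: level_def clamp01_def)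

subsection \<open>Orthogonality over shifts\<close>

lemma sum_periodic_shift:
  fixes f :: "nat \<Rightarrow> 'a::ab_group_add"
  assumes "\<And>n. f (n + q) = f n"
  shows "(\<Sum>n<q. f (n + c)) = (\<Sum>n<q. f n)"
proof (induction c)
  case (Suc c)
  define g where "g = (\<lambda>n. f (n + c))"
  have "(\<Sum>n<Suc q. g n) = g 0 + (\<Sum>n<q. g (Suc n))" by (rule sum.lessThan_Suc_shift)
  moreover have "g q = g 0" using assms[of c] by (simp add: g_def add.commute)
  ultimately have "(\<Sum>n<q. g (Suc n)) = (\<Sum>n<q. g n)" by (simp add: add.commute)
  then show ?case using Suc by (simp add: g_def)
qed simp

lemma sum_periodic_mod:
  fixes f :: "nat \<Rightarrow> 'a::ab_group_add"
  assumes "\<And>n. f (n + q) = f n" "(\<Sum>n<q. f n) = 0"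
  shows "(\<Sum>n<M. f n) = (\<Sum>n<M mod q. f n)"
proof (induction M rule: less_induct)
  case (less M)
  show ?case
  proof (cases "q = 0 \<or> M < q")
    case False
    then obtain K where K: "M = q + K" "K < M" by (metis add_diff_inverse_nat diff_less gr_zeroI less_nat_zero_code)
    have "(\<Sum>n<q + K. f n) = (\<Sum>n<q. f n) + (\<Sum>n<K. f (n + q))"
      by (induction K) (simp_all add: ac_simps)
    then show ?thesis using less[of K] K assms by simp
  qed auto
qed

lemma card_interval_cong_le:
  fixes X :: "nat set"
  assumes X: "X \<subseteq> {..<m * q}" and q: "0 < q"
    and cong: "\<And>x y. x \<in> X \<Longrightarrow> y \<in> X \<Longrightarrow> x mod q = y mod q"
  shows "card X \<le> m"
proof -
  have "inj_on (\<lambda>x. x div q) X"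
    by (rule inj_onI) (metis cong div_mult_mod_eq)
  moreover have "(\<lambda>x. x div q) ` X \<subseteq> {..<m}"
    using X q by (auto simp: less_mult_imp_div_less)
  ultimately have "card X \<le> card {..<m}"
    by (intro card_inj_on_le) auto
  then show ?thesis by simp
qed

lemma mod_prod_eq:
  fixes m n :: nat
  assumes "finite I" "\<And>i. i \<in> I \<Longrightarrow> m mod q i = n mod q i"
    and "\<And>i j. i \<in> I \<Longrightarrow> j \<in> I \<Longrightarrow> i \<noteq> j \<Longrightarrow> coprime (q i) (q j)"
  shows "m mod (\<Prod>i\<in>I. q i) = n mod (\<Prod>i\<in>I. q i)"
  using coprime_cong_prod_nat[of I q m n] assms by (auto simp: cong_def)

section \<open>Products of level differences over coprime bases\<close>

locale coprime_bases =
  fixes s h :: nat and b :: "nat \<Rightarrow> nat"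
  assumes b_gt_1: "\<And>i. 1 < b i"
    and b_coprime: "\<And>i j. i \<noteq> j \<Longrightarrow> coprime (b i) (b j)"
begin

text \<open>A common period of all levels up to \<open>h\<close>, so sums over \<open>T < Q\<close>
  do not change when \<open>T\<close> is shifted.\<close>

definition Q :: nat where
  "Q = (\<Prod>i<s. b i ^ h)"

lemma Q_pos: "0 < Q"
  unfolding Q_def using b_gt_1 by (auto intro!: prod_pos zero_less_power dest: Suc_lessD)

end

text \<open>The properties of level differences on which orthogonality rests, freed from digits.
  \<open>W e\<close> below is one term of the multiplied-out box indicator, \<open>e i\<close> being
  the level taken in coordinate \<open>i\<close>.\<close>

locale level_family = coprime_bases +
  fixes E :: "nat \<Rightarrow> nat \<Rightarrow> nat \<Rightarrow> real"
  assumes E_cong: "\<And>i e m n. i < s \<Longrightarrow> m mod b i ^ e = n mod b i ^ e \<Longrightarrow> E i e m = E i e n"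
    and abs_E_le: "\<And>i e n. i < s \<Longrightarrow> \<bar>E i e n\<bar> \<le> 1"
    and E_support: "\<And>i e m n. i < s \<Longrightarrow> E i e m \<noteq> 0 \<Longrightarrow> E i e n \<noteq> 0 \<Longrightarrow>
      m mod b i ^ (e - 1) = n mod b i ^ (e - 1)"
    and E_shift_sum: "\<And>i e c n. i < s \<Longrightarrow> 0 < e \<Longrightarrow> coprime c (b i) \<Longrightarrow>
      (\<Sum>k<b i. E i e (n + k * (c * b i ^ (e - 1)))) = 0"
begin

definition W :: "(nat \<Rightarrow> nat) \<Rightarrow> nat \<Rightarrow> real" where
  "W e n = (\<Prod>i<s. E i (e i) n)"

definition S :: "(nat \<Rightarrow> nat) \<Rightarrow> nat \<Rightarrow> nat \<Rightarrow> real" where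
  "S e M T = (\<Sum>n<M. W e (T + n))"

lemma W_periodic:
  assumes "\<And>i. i < s \<Longrightarrow> b i ^ e i dvd L"
  shows "W e (n + L) = W e n"
  unfolding W_def
proof (rule prod.cong)
  fix i assume "i \<in> {..<s}"
  then have "(n + L) mod b i ^ e i = n mod b i ^ e i"
    using assms[of i] by (auto elim!: dvdE)
  then show "E i (e i) (n + L) = E i (e i) n" using \<open>i \<in> {..<s}\<close> by (intro E_cong) auto
qed simp

text \<open>Since \<open>c\<close> absorbs the other moduli, the shift moves only factor
  \<open>i\<close>; the others come out of the sum.\<close>

lemma W_shift_sum:
  assumes i: "i < s" "0 < e i" and c: "coprime c (b i)"
    and L: "\<And>j. j < s \<Longrightarrow> j \<noteq> i \<Longrightarrow> b j ^ e j dvd c"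
  shows "(\<Sum>k<b i. W e (n + k * (c * b i ^ (e i - 1)))) = 0"
proof -
  have "W e (n + k * (c * b i ^ (e i - 1))) =
      E i (e i) (n + k * (c * b i ^ (e i - 1))) * (\<Prod>j\<in>{..<s} - {i}. E j (e j) n)" for k
  proof -
    have "E j (e j) (n + k * (c * b i ^ (e i - 1))) = E j (e j) n" if "j \<in> {..<s} - {i}" for j
    proof (rule E_cong)
      have "b j ^ e j dvd k * (c * b i ^ (e i - 1))"
        using L[of j] that by auto
      then show "(n + k * (c * b i ^ (e i - 1))) mod b j ^ e j = n mod b j ^ e j"
        by (auto elim!: dvdE)
    qed (use that in auto)
    then show ?thesis
      using i(1) by (simp add: W_def prod.remove[of "{..<s}" i])
  qed
  then show ?thesis
    using E_shift_sum[OF i c, of n] by (simp flip: sum_distrib_right)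
qed

lemma coprime_prod_powers:
  assumes "i < s"
  shows "coprime (\<Prod>j\<in>{..<s} - {i}. b j ^ f j) (b i)"
  using assms b_coprime by (intro prod_coprime_left) auto

lemma abs_W_le: "\<bar>W e n\<bar> \<le> 1"
  unfolding W_def abs_prod by (intro prod_le_1) (auto simp: abs_E_le)

text \<open>A sum over a full period equals its mean over the \<open>b i\<close> shifts by multiples
  of \<open>L\<close>, and that is 0 by \<open>W_shift_sum\<close>.\<close>

lemma sum_W_full_period:
  assumes i: "i < s" "0 < e i"
  shows "(\<Sum>n<(\<Prod>j<s. b j ^ e j). W e (T + n)) = 0"
proof -
  define q where "q = (\<Prod>j<s. b j ^ e j)"
  define c where "c = (\<Prod>j\<in>{..<s} - {i}. b j ^ e j)"
  define L where "L = c * b i ^ (e i - 1)"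
  have per: "W e (T + (n + q)) = W e (T + n)" for n
    using W_periodic[of e q "T + n"] by (auto simp: q_def add.assoc intro!: dvd_prodI)
  have "real (b i) * (\<Sum>n<q. W e (T + n)) = (\<Sum>k<b i. \<Sum>n<q. W e (T + (n + k * L)))"
    using sum_periodic_shift[of "\<lambda>n. W e (T + n)" q, OF per] by simp
  also have "\<dots> = (\<Sum>n<q. \<Sum>k<b i. W e (T + n + k * L))"
    by (subst sum.swap) (simp add: add.assoc)
  also have "\<dots> = 0"
    unfolding L_def c_def using i
    by (intro sum.neutral ballI W_shift_sum coprime_prod_powers) (auto intro!: dvd_prodI)
  finally show ?thesis using b_gt_1[of i] by (simp add: q_def)
qed

text \<open>Full periods cancel and leave fewer than \<open>q\<close> terms. By the Chinese
  remainder theorem the nonzero ones lie in one residue class modulo \<open>q'\<close>, and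
  \<open>q\<close> is at most \<open>q'\<close> times the product of the bases.\<close>

lemma abs_S_le:
  assumes i: "i < s" "0 < e i"
  shows "\<bar>S e M T\<bar> \<le> (\<Prod>j<s. real (b j))"
proof -
  define q where "q = (\<Prod>j<s. b j ^ e j)"
  define q' where "q' = (\<Prod>j<s. b j ^ (e j - 1))"
  define X where "X = {n. n < M mod q \<and> W e (T + n) \<noteq> 0}"
  have q_pos: "0 < q" "0 < q'" unfolding q_def q'_def
    using b_gt_1 by (auto intro!: prod_pos zero_less_power dest: Suc_lessD)
  have per: "W e (T + (n + q)) = W e (T + n)" for n
    using W_periodic[of e q "T + n"] by (auto simp: q_def add.assoc intro!: dvd_prodI)
  have "S e M T = (\<Sum>n<M mod q. W e (T + n))"
    unfolding S_def using per sum_W_full_period[of i e T] i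
    by (intro sum_periodic_mod) (auto simp: q_def)
  also have "\<dots> = (\<Sum>n\<in>X. W e (T + n))"
    unfolding X_def by (intro sum.mono_neutral_right) auto
  also have "\<bar>\<dots>\<bar> \<le> (\<Sum>n\<in>X. 1)"
    using abs_W_le by (intro order.trans[OF sum_abs] sum_mono) auto
  also have "\<dots> = real (card X)" by simp
  also have "card X \<le> (\<Prod>j<s. b j)"
  proof (rule card_interval_cong_le[OF _ q_pos(2)])
    \<comment> \<open>Not an equality: where \<open>e j = 0\<close>, both \<open>b j ^ e j\<close>
      and \<open>b j ^ (e j - 1)\<close> are 1.\<close>
    have "q \<le> (\<Prod>j<s. b j) * q'"
      unfolding q_def q'_def prod.distrib[symmetric]
    proof (intro prod_mono conjI)
      fix j assume "j \<in> {..<s}"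
      then show "b j ^ e j \<le> b j * b j ^ (e j - 1)"
        using b_gt_1[of j] by (cases "e j") auto
    qed simp
    then show "X \<subseteq> {..<(\<Prod>j<s. b j) * q'}"
      using q_pos mod_less_divisor[of q M] by (auto simp: X_def simp del: mod_less_divisor)
  next
    fix x y assume "x \<in> X" "y \<in> X"
    then have nz: "E j (e j) (T + x) \<noteq> 0" "E j (e j) (T + y) \<noteq> 0" if "j < s" for j
      using that by (auto simp: X_def W_def)
    have "(T + x) mod q' = (T + y) mod q'"
      unfolding q'_def using nz b_coprime by (intro mod_prod_eq E_support) auto
    then show "x mod q' = y mod q'"
      using cong_add_lcancel_nat[of T x y q'] by (simp add: cong_def)
  qed
  finally show ?thesis by simp
qed

section \<open>Orthogonality and the second moment\<close>

text \<open>Average over shifts of \<open>T\<close> by multiples of \<open>L\<close>: they are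
  periods of \<open>W e'\<close>, whose level at \<open>i\<close> is lower, so \<open>S e'\<close>
  stays fixed while the values of \<open>S e\<close> sum to 0.\<close>

lemma S_orthogonal_aux:
  assumes e: "\<And>j. j < s \<Longrightarrow> e j \<le> h" "\<And>j. j < s \<Longrightarrow> e' j \<le> h"
    and i: "i < s" "e' i < e i"
  shows "(\<Sum>T<Q. S e M T * S e' M T) = 0"
proof -
  \<comment> \<open>The exponent is \<open>h\<close>, so that \<open>c\<close> absorbs the moduli of
    both \<open>e\<close> and \<open>e'\<close>.\<close>
  define c where "c = (\<Prod>j\<in>{..<s} - {i}. b j ^ h)"
  define L where "L = c * b i ^ (e i - 1)"
  have dvd_c: "b j ^ f j dvd c" if "j < s" "j \<noteq> i" "f j \<le> h" for j f
  proof -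
    have "b j ^ f j dvd b j ^ h" using that by (simp add: le_imp_power_dvd)
    also have "\<dots> dvd c" unfolding c_def using that by (intro dvd_prodI) auto
    finally show ?thesis .
  qed
  have "b j ^ f j dvd Q" if "j < s" "f j \<le> h" for j f
  proof -
    have "b j ^ f j dvd b j ^ h" using that by (simp add: le_imp_power_dvd)
    also have "\<dots> dvd Q" unfolding Q_def using that by (intro dvd_prodI) auto
    finally show ?thesis .
  qed
  then have perQ: "S f M (T + Q) = S f M T" if "\<And>j. j < s \<Longrightarrow> f j \<le> h" for f T
    using W_periodic[of f Q "T + n" for n] that by (simp add: S_def ac_simps)
  have perL: "S e' M (T + k * L) = S e' M T" for k T
  proof -
    have "b j ^ e' j dvd k * L" if "j < s" for j
    proof (cases "j = i")
      case True
      have "b i ^ e' i dvd b i ^ (e i - 1)" using i by (intro le_imp_power_dvd) auto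
      then show ?thesis using True by (simp add: L_def)
    qed (use dvd_c[of j e'] that e in \<open>auto simp: L_def\<close>)
    then have "W e' (T + n + k * L) = W e' (T + n)" for n
      by (intro W_periodic) auto
    then show ?thesis by (simp add: S_def ac_simps)
  qed
  have sumL: "(\<Sum>k<b i. S e M (T + k * L)) = 0" for T
  proof -
    have "(\<Sum>k<b i. S e M (T + k * L)) = (\<Sum>n<M. \<Sum>k<b i. W e (T + n + k * L))"
      unfolding S_def by (subst sum.swap) (simp add: ac_simps)
    also have "\<dots> = 0"
      unfolding L_def using i e dvd_c
      by (intro sum.neutral ballI W_shift_sum) (auto simp: c_def intro!: coprime_prod_powers)
    finally show ?thesis .
  qed
  have "real (b i) * (\<Sum>T<Q. S e M T * S e' M T) =
      (\<Sum>k<b i. \<Sum>T<Q. S e M (T + k * L) * S e' M (T + k * L))"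
    using sum_periodic_shift[of "\<lambda>T. S e M T * S e' M T" Q] perQ e by simp
  also have "\<dots> = (\<Sum>T<Q. (\<Sum>k<b i. S e M (T + k * L)) * S e' M T)"
    by (subst sum.swap) (simp add: perL sum_distrib_right)
  also have "\<dots> = 0" by (simp add: sumL)
  finally show ?thesis using b_gt_1[of i] by simp
qed

lemma S_orthogonal:
  assumes e: "e \<in> {..<s} \<rightarrow>\<^sub>E {..h}" "e' \<in> {..<s} \<rightarrow>\<^sub>E {..h}" "e \<noteq> e'"
  shows "(\<Sum>T<Q. S e M T * S e' M T) = 0"
proof -
  obtain i where i: "i < s" "e i \<noteq> e' i"
    using e by (metis PiE_ext lessThan_iff)
  have le: "e j \<le> h" "e' j \<le> h" if "j < s" for j
    using e that by auto
  show ?thesis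
  proof (cases "e' i < e i")
    case True
    then show ?thesis using i le by (intro S_orthogonal_aux) auto
  next
    case False
    then have "(\<Sum>T<Q. S e' M T * S e M T) = 0"
      using i le by (intro S_orthogonal_aux[of e' e i]) auto
    then show ?thesis by (simp add: mult.commute)
  qed
qed

text \<open>Off-diagonal products vanish on summation, and \<open>abs_S_le\<close> bounds each
  diagonal one. The all-zero index, which carries the mean, is left out: \<open>abs_S_le\<close>
  asks for a positive level.\<close>

lemma second_moment:
  "(\<Sum>T<Q. (\<Sum>e\<in>({..<s} \<rightarrow>\<^sub>E {..h}) - {\<lambda>i\<in>{..<s}. 0}. S e M T)\<^sup>2)
    \<le> real Q * (real (Suc h) ^ s * (\<Prod>j<s. real (b j))\<^sup>2)"
proof -
  define I where "I = ({..<s} \<rightarrow>\<^sub>E {..h}) - {\<lambda>i\<in>{..<s}. 0::nat}"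
  define P where "P = (\<Prod>j<s. real (b j))"
  have fin: "finite I" unfolding I_def by (intro finite_Diff finite_PiE) auto
  have "card I \<le> card ({..<s} \<rightarrow>\<^sub>E {..h})"
    unfolding I_def by (intro card_mono finite_PiE) auto
  also have "\<dots> = Suc h ^ s" by (simp add: card_PiE)
  finally have card: "real (card I) \<le> real (Suc h) ^ s"
    by (metis of_nat_le_iff of_nat_power)
  have bound: "(S e M T)\<^sup>2 \<le> P\<^sup>2" if "e \<in> I" for e T
  proof -
    have "\<exists>i<s. 0 < e i"
    proof (rule ccontr)
      assume "\<not> (\<exists>i<s. 0 < e i)"
      then have "e = (\<lambda>i\<in>{..<s}. 0)"
        using that by (intro PiE_ext[of e "{..<s}" "\<lambda>_. {..h}"]) (auto simp: I_def)
      then show False using that by (simp add: I_def)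
    qed
    then have "\<bar>S e M T\<bar> \<le> P" unfolding P_def using abs_S_le by blast
    then show ?thesis by (metis abs_ge_zero power2_abs power_mono)
  qed
  have "(\<Sum>T<Q. (\<Sum>e\<in>I. S e M T)\<^sup>2) = (\<Sum>e\<in>I. \<Sum>e'\<in>I. \<Sum>T<Q. S e M T * S e' M T)"
    by (simp add: power2_eq_square sum_product sum.swap[of _ "{..<Q}"])
  also have "\<dots> = (\<Sum>e\<in>I. \<Sum>T<Q. (S e M T)\<^sup>2)"
  proof (rule sum.cong)
    fix e assume e: "e \<in> I"
    have "(\<Sum>e'\<in>I. \<Sum>T<Q. S e M T * S e' M T) = (\<Sum>e'\<in>{e}. \<Sum>T<Q. S e M T * S e' M T)"
      using e fin by (intro sum.mono_neutral_right) (auto intro!: S_orthogonal simp: I_def)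
    then show "(\<Sum>e'\<in>I. \<Sum>T<Q. S e M T * S e' M T) = (\<Sum>T<Q. (S e M T)\<^sup>2)"
      by (simp add: power2_eq_square)
  qed simp
  also have "\<dots> \<le> (\<Sum>e\<in>I. \<Sum>T<Q. P\<^sup>2)"
    by (intro sum_mono bound)
  also have "\<dots> = real Q * (real (card I) * P\<^sup>2)" by simp
  also have "\<dots> \<le> real Q * (real (Suc h) ^ s * P\<^sup>2)"
    using card by (intro mult_left_mono mult_right_mono) auto
  finally show ?thesis by (simp add: I_def P_def)
qed

end

subsection \<open>Shifted Halton points\<close>

lemma coprime_bases_exist:
  "\<exists>b :: nat \<Rightarrow> nat. (\<forall>i. 1 < b i) \<and> (\<forall>i j. i \<noteq> j \<longrightarrow> coprime (b i) (b j))"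
proof -
  define b where "b = enumerate {p::nat. prime p}"
  have inf: "infinite {p::nat. prime p}" by (rule primes_infinite)
  have p: "prime (b i)" for i
    using enumerate_in_set[OF inf, of i] by (simp add: b_def)
  have "inj b"
    unfolding b_def using strict_mono_enumerate[OF inf] by (rule strict_mono_imp_inj_on)
  then have "coprime (b i) (b j)" if "i \<noteq> j" for i j
    using p that by (auto intro!: primes_coprime dest: injD)
  then show ?thesis using p prime_gt_1_nat by blast
qed

text \<open>The corner is given by integers \<open>Y j\<close> in units of
  \<open>1 / b j ^ h\<close>, as \<open>level_top\<close> requires.\<close>

definition box_count :: "nat \<Rightarrow> nat \<Rightarrow> (nat \<Rightarrow> nat) \<Rightarrow> (nat \<Rightarrow> nat) \<Rightarrow> nat \<Rightarrow> nat \<Rightarrow> real" where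
  "box_count s h b Y M T = (\<Sum>n<M. \<Prod>j<s. of_bool (digit_rev (b j) h (T + n) < Y j))"

section \<open>Mean deviation for boxes with corners on the grid\<close>

context coprime_bases
begin

definition rms :: real where
  "rms = sqrt (real (Suc h) ^ s) * (\<Prod>j<s. real (b j))"

lemma box_count_second_moment:
  assumes Y: "\<And>j. j < s \<Longrightarrow> Y j \<le> b j ^ h"
  shows "(\<Sum>T<Q. (box_count s h b Y M T - real M * (\<Prod>j<s. real (Y j) / real (b j) ^ h))\<^sup>2)
    \<le> real Q * rms\<^sup>2"
proof -
  \<comment> \<open>The default 0 makes the bounds on \<open>y\<close> hold at every index, while
    \<open>Y\<close> is bounded only below \<open>s\<close>.\<close>
  define y where "y = (\<lambda>j. if j < s then real (Y j) / real (b j) ^ h else 0)"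
  have b0: "0 < b i" for i using b_gt_1[of i] by simp
  have pos: "0 < real (b i) ^ h" for i using b0 by simp
  have y: "0 \<le> y j" "y j \<le> 1" for j
    using Y[of j] pos[of j] by (auto simp: y_def divide_le_eq_1 simp flip: of_nat_power)
  have yY: "y j * real (b j) ^ h = real (Y j)" if "j < s" for j
    using pos[of j] that by (simp add: y_def)
  interpret level_family s h b "\<lambda>i. level_diff (b i) (y i)"
  proof
    show "level_diff (b i) (y i) e m = level_diff (b i) (y i) e n"
      if "m mod b i ^ e = n mod b i ^ e" for i e m n
      using b0 that by (rule level_diff_cong)
    show "\<bar>level_diff (b i) (y i) e n\<bar> \<le> 1" for i e n
      using y by (rule abs_level_diff_le)
    show "m mod b i ^ (e - 1) = n mod b i ^ (e - 1)"
      if "level_diff (b i) (y i) e m \<noteq> 0" "level_diff (b i) (y i) e n \<noteq> 0" for i e m n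
      using b_gt_1 that by (rule level_diff_support)
    show "(\<Sum>k<b i. level_diff (b i) (y i) e (n + k * (c * b i ^ (e - 1)))) = 0"
      if "0 < e" "coprime c (b i)" for i e c n
      using b_gt_1 that by (rule level_diff_shift_sum)
  qed
  define z where "z = (\<lambda>i\<in>{..<s}. 0::nat)"
  define I where "I = ({..<s} \<rightarrow>\<^sub>E {..h})"
  have fin: "finite I" unfolding I_def by (intro finite_PiE) auto
  have z: "z \<in> I" unfolding I_def z_def by auto
  have ind: "(\<Prod>j<s. of_bool (digit_rev (b j) h n < Y j)) = (\<Sum>e\<in>I. W e n)" for n
  proof -
    have "(\<Prod>j<s. of_bool (digit_rev (b j) h n < Y j)) = (\<Prod>j<s. \<Sum>e\<le>h. level_diff (b j) (y j) e n)"
      using yY by (intro prod.cong) (auto simp: sum_level_diff[OF y] level_top)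
    also have "\<dots> = (\<Sum>e\<in>I. W e n)"
      unfolding W_def I_def by (rule prod_sum_PiE) auto
    finally show ?thesis .
  qed
  \<comment> \<open>The all-zero index contributes exactly the expected count; subtracting it leaves
    the sum in \<open>second_moment\<close>.\<close>
  have "W z n = (\<Prod>j<s. y j)" for n
    unfolding W_def z_def by (intro prod.cong) (auto simp: level_diff_def)
  then have Sz: "S z M T = real M * (\<Prod>j<s. y j)" for T
    by (simp add: S_def)
  have "box_count s h b Y M T - real M * (\<Prod>j<s. y j) = (\<Sum>e\<in>I - {z}. S e M T)" for T
  proof -
    have "box_count s h b Y M T = (\<Sum>e\<in>I. S e M T)"
      unfolding box_count_def ind S_def by (rule sum.swap)
    then show ?thesis using fin z by (simp add: sum.remove[of I z] Sz)
  qed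
  moreover have "(\<Prod>j<s. real (Y j) / real (b j) ^ h) = (\<Prod>j<s. y j)"
    by (intro prod.cong) (auto simp: y_def)
  ultimately have "(\<Sum>T<Q. (box_count s h b Y M T - real M * (\<Prod>j<s. real (Y j) / real (b j) ^ h))\<^sup>2)
      = (\<Sum>T<Q. (\<Sum>e\<in>I - {z}. S e M T)\<^sup>2)"
    by simp
  also have "\<dots> \<le> real Q * (real (Suc h) ^ s * (\<Prod>j<s. real (b j))\<^sup>2)"
    using second_moment[of M] unfolding I_def z_def by simp
  also have "real (Suc h) ^ s * (\<Prod>j<s. real (b j))\<^sup>2 = rms\<^sup>2"
    by (simp add: rms_def power_mult_distrib)
  finally show ?thesis .
qed

lemma rms_nonneg: "0 \<le> rms"
  unfolding rms_def by (auto intro!: mult_nonneg_nonneg prod_nonneg)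

lemma box_count_mean_deviation:
  assumes Y: "\<And>j. j < s \<Longrightarrow> Y j \<le> b j ^ h"
  shows "(\<Sum>T<Q. \<bar>box_count s h b Y M T - real M * (\<Prod>j<s. real (Y j) / real (b j) ^ h)\<bar>)
    \<le> real Q * rms"
proof -
  define X where "X = (\<lambda>T. box_count s h b Y M T - real M * (\<Prod>j<s. real (Y j) / real (b j) ^ h))"
  have "(\<Sum>T<Q. \<bar>X T\<bar> * 1)\<^sup>2 \<le> (\<Sum>T<Q. \<bar>X T\<bar>\<^sup>2) * (\<Sum>T<Q. 1\<^sup>2)"
    by (rule Cauchy_Schwarz_ineq_sum)
  also have "\<dots> \<le> (real Q * rms\<^sup>2) * real Q"
    using box_count_second_moment[OF Y, of M] by (auto intro!: mult_right_mono simp: X_def)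
  also have "\<dots> = (real Q * rms)\<^sup>2" by (simp add: power2_eq_square)
  finally show ?thesis
    using rms_nonneg by (auto simp: X_def intro: power2_le_imp_le)
qed

section \<open>Mean deviation for arbitrary boxes\<close>

definition halton :: "nat \<Rightarrow> nat \<Rightarrow> nat \<Rightarrow> real" where
  "halton T n j = real (digit_rev (b j) h (T + n)) / real (b j) ^ h"

lemma halton_bounds: "0 \<le> halton T n j" "halton T n j < 1"
proof -
  have "real (digit_rev (b j) h (T + n)) < real (b j ^ h)"
    using b_gt_1[of j] by (subst of_nat_less_iff) (intro digit_rev_less, simp)
  then show "halton T n j < 1" "0 \<le> halton T n j"
    using b_gt_1[of j] by (auto simp: halton_def)
qed

definition halton_count :: "nat \<Rightarrow> nat \<Rightarrow> (nat \<Rightarrow> real) \<Rightarrow> real" where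
  "halton_count N T x =
     (\<Sum>n<N. of_bool (real n / real N < x s \<and> (\<forall>j<s. halton T n j < x j)))"

lemma prod_of_bool: "finite A \<Longrightarrow> (\<Prod>j\<in>A. of_bool (R j)) = (of_bool (\<forall>j\<in>A. R j) :: real)"
  by (induction A rule: finite_induct) auto

text \<open>Rounding the corner up to the grid of the points leaves the count unchanged, as the
  inequalities are strict. The expected count moves by at most 1 for the last coordinate and, since
  \<open>N \<le> 2 ^ h \<le> b j ^ h\<close>, by at most 1 for each of the others.\<close>

lemma halton_mean_deviation:
  assumes N: "0 < N" "N \<le> 2 ^ h" and x: "\<And>j. j \<le> s \<Longrightarrow> 0 \<le> x j \<and> x j \<le> 1"
  shows "(\<Sum>T<Q. \<bar>halton_count N T x - real N * (\<Prod>j<Suc s. x j)\<bar>)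
    \<le> real Q * (rms + 1 + real s)"
proof -
  define M where "M = nat \<lceil>real N * x s\<rceil>"
  define Y where "Y = (\<lambda>j. nat \<lceil>real (b j) ^ h * x j\<rceil>)"
  define y where "y = (\<lambda>j. real (Y j) / real (b j) ^ h)"
  have pos: "0 < real (b i) ^ h" for i using b_gt_1[of i] by simp
  have less: "real m < u \<longleftrightarrow> m < nat \<lceil>u\<rceil>" for m u
    by (metis less_ceiling_iff of_int_of_nat_eq zless_nat_eq_int_zless)
  have le: "nat \<lceil>u\<rceil> \<le> m" if "u \<le> real m" for m u
    using that by (simp add: ceiling_le_iff nat_le_iff)
  have near: "0 \<le> real (nat \<lceil>u\<rceil>) - u \<and> real (nat \<lceil>u\<rceil>) - u \<le> 1" if "0 \<le> u" for u
    using that by linarith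
  have M_le: "M \<le> N" unfolding M_def using x[of s] N by (intro le) (auto intro: mult_left_le)
  have Y_le: "Y j \<le> b j ^ h" if "j < s" for j
    unfolding Y_def using x[of j] that by (intro le) (auto intro!: mult_left_le)
  have count: "halton_count N T x = box_count s h b Y M T" for T
  proof -
    have "halton_count N T x = (\<Sum>n<N. if n < M then of_bool (\<forall>j<s. halton T n j < x j) else 0)"
      unfolding halton_count_def M_def
      by (intro sum.cong) (use N in \<open>auto simp: pos_divide_less_eq mult.commute simp flip: less\<close>)
    also have "\<dots> = (\<Sum>n<M. of_bool (\<forall>j<s. halton T n j < x j))"
      using M_le by (intro sum.mono_neutral_cong_right) auto
    also have "\<dots> = box_count s h b Y M T"
      unfolding box_count_def halton_def Y_def
      by (intro sum.cong)
        (auto simp: prod_of_bool pos_divide_less_eq[OF pos] mult.commute simp flip: less)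
    finally show ?thesis .
  qed
  have y: "0 \<le> y j - x j \<and> y j - x j \<le> 1 / 2 ^ h \<and> 0 \<le> y j \<and> y j \<le> 1" if "j < s" for j
  proof -
    have "0 \<le> real (Y j) - real (b j) ^ h * x j" "real (Y j) - real (b j) ^ h * x j \<le> 1"
      using near[of "real (b j) ^ h * x j"] x[of j] that pos[of j] by (auto simp: Y_def)
    moreover have "y j - x j = (real (Y j) - real (b j) ^ h * x j) / real (b j) ^ h"
      using pos[of j] by (simp add: y_def field_simps)
    ultimately have 1: "0 \<le> y j - x j" "y j - x j \<le> 1 / real (b j) ^ h"
      using pos[of j] by (auto intro!: divide_right_mono)
    have "1 / real (b j) ^ h \<le> 1 / 2 ^ h"
      using b_gt_1[of j] by (intro divide_left_mono power_mono) auto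
    moreover have "y j \<le> 1"
      using Y_le[OF that] pos[of j] by (auto simp: y_def divide_le_eq_1 simp flip: of_nat_power)
    ultimately show ?thesis using 1 by (auto simp: y_def)
  qed
  have "norm ((\<Prod>j<s. y j) - (\<Prod>j<s. x j)) \<le> (\<Sum>j<s. norm (y j - x j))"
    using y x by (intro norm_prod_diff) (simp_all add: less_imp_le)
  then have "\<bar>(\<Prod>j<s. y j) - (\<Prod>j<s. x j)\<bar> \<le> (\<Sum>j<s. \<bar>y j - x j\<bar>)"
    by simp
  also have "\<dots> \<le> (\<Sum>j<s. 1 / 2 ^ h)"
    using y by (intro sum_mono) (simp add: abs_of_nonneg)
  finally have diff: "\<bar>(\<Prod>j<s. y j) - (\<Prod>j<s. x j)\<bar> \<le> real s / 2 ^ h" by simp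
  have prod01: "0 \<le> (\<Prod>j<s. x j)" "(\<Prod>j<s. x j) \<le> 1"
    using x by (auto intro!: prod_nonneg prod_le_1)
  have "\<bar>real M * (\<Prod>j<s. y j) - real N * (\<Prod>j<Suc s. x j)\<bar> \<le> 1 + real s"
  proof -
    have "real M * (\<Prod>j<s. y j) - real N * (\<Prod>j<Suc s. x j) =
        real M * ((\<Prod>j<s. y j) - (\<Prod>j<s. x j)) + (real M - real N * x s) * (\<Prod>j<s. x j)"
      by (simp add: algebra_simps)
    moreover have "\<bar>real M * ((\<Prod>j<s. y j) - (\<Prod>j<s. x j))\<bar> \<le> 2 ^ h * (real s / 2 ^ h)"
    proof -
      have "real M \<le> real (2 ^ h)" using M_le N(2) by (subst of_nat_le_iff) linarith
      then show ?thesis unfolding abs_mult using diff by (intro mult_mono) auto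
    qed
    moreover have "\<bar>(real M - real N * x s) * (\<Prod>j<s. x j)\<bar> \<le> 1 * 1"
      unfolding abs_mult using near[of "real N * x s"] x[of s] prod01
      by (intro mult_mono) (auto simp: M_def)
    ultimately show ?thesis by auto
  qed
  then have "\<bar>halton_count N T x - real N * (\<Prod>j<Suc s. x j)\<bar>
      \<le> \<bar>box_count s h b Y M T - real M * (\<Prod>j<s. y j)\<bar> + (1 + real s)" for T
    unfolding count by linarith
  then have "(\<Sum>T<Q. \<bar>halton_count N T x - real N * (\<Prod>j<Suc s. x j)\<bar>)
      \<le> (\<Sum>T<Q. \<bar>box_count s h b Y M T - real M * (\<Prod>j<s. y j)\<bar> + (1 + real s))"
    by (intro sum_mono)
  also have "\<dots> \<le> real Q * rms + real Q * (1 + real s)"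
    using box_count_mean_deviation[OF Y_le, of M] by (simp add: sum.distrib y_def)
  finally show ?thesis by (simp add: algebra_simps)
qed

end

subsection \<open>Clustering the last points\<close>

lemma unit_cube_coord:
  assumes "x \<in> unit_cube d" "j < d"
  shows "0 \<le> x j" "x j \<le> 1"
  using assms by (auto simp: unit_cube_def PiE_iff)

text \<open>At distance at least \<open>l / 4\<close> from the root \<open>K / V\<close> the square
  is at least \<open>(V * (l / 4)) ^ 2\<close>, and at least \<open>l / 2\<close> of the interval is
  that far away. The bound is uniform in \<open>K\<close>, which will be an uncontrolled count of
  points.\<close>

lemma nn_integral_affine_square_ge:
  fixes K V a l :: real
  assumes "0 \<le> V" "0 \<le> l"
  shows "ennreal (V\<^sup>2 * l ^ 3 / 32) \<le> (\<integral>\<^sup>+y. ennreal ((K - V * y)\<^sup>2) * indicator {a..a + l} y \<partial>lborel)"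
proof (cases "V = 0")
  case False
  then have V: "0 < V" using assms by simp
  define c where "c = K / V"
  define J where "J = {c - l / 4<..<c + l / 4}"
  have J: "emeasure lborel J = ennreal (l / 2)"
    unfolding J_def using assms by simp
  have "ennreal l = emeasure lborel {a..a + l}" using assms by simp
  also have "\<dots> \<le> emeasure lborel (({a..a + l} - J) \<union> J)"
    by (intro emeasure_mono) (auto simp: J_def)
  also have "\<dots> \<le> emeasure lborel ({a..a + l} - J) + emeasure lborel J"
    by (intro emeasure_subadditive) (auto simp: J_def)
  finally have "ennreal l - ennreal (l / 2) \<le> emeasure lborel ({a..a + l} - J)"
    by (simp add: J ennreal_minus_le_iff add.commute)
  then have half: "ennreal (l / 2) \<le> emeasure lborel ({a..a + l} - J)"
    using assms by (simp add: ennreal_minus)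
  have "ennreal (V\<^sup>2 * l ^ 3 / 32) = ennreal ((V * (l / 4))\<^sup>2) * ennreal (l / 2)"
    using assms by (simp add: ennreal_mult[symmetric] power2_eq_square power3_eq_cube)
  also have "\<dots> \<le> ennreal ((V * (l / 4))\<^sup>2) * emeasure lborel ({a..a + l} - J)"
    by (intro mult_left_mono half) simp
  also have "\<dots> = (\<integral>\<^sup>+y. ennreal ((V * (l / 4))\<^sup>2) * indicator ({a..a + l} - J) y \<partial>lborel)"
    by (subst nn_integral_cmult_indicator) (auto simp: J_def)
  also have "\<dots> \<le> (\<integral>\<^sup>+y. ennreal ((K - V * y)\<^sup>2) * indicator {a..a + l} y \<partial>lborel)"
  proof (intro nn_integral_mono)
    fix y :: real
    have "(V * (l / 4))\<^sup>2 \<le> (K - V * y)\<^sup>2" if "y \<notin> J"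
    proof -
      have "l / 4 \<le> \<bar>c - y\<bar>" using that by (auto simp: J_def abs_if)
      then have "V * (l / 4) \<le> V * \<bar>c - y\<bar>" using V by (intro mult_left_mono) auto
      also have "\<dots> = \<bar>V * (c - y)\<bar>" using V by (simp add: abs_mult)
      also have "V * (c - y) = K - V * y" using V by (simp add: c_def right_diff_distrib)
      finally have "(V * (l / 4))\<^sup>2 \<le> \<bar>K - V * y\<bar>\<^sup>2"
        using V assms by (intro power_mono) auto
      then show ?thesis by simp
    qed
    then show "ennreal ((V * (l / 4))\<^sup>2) * indicator ({a..a + l} - J) y
        \<le> ennreal ((K - V * y)\<^sup>2) * indicator {a..a + l} y"
      by (auto simp: indicator_def intro!: ennreal_leI)
  qed
  finally show ?thesis .
qed simp

section \<open>The clustered point set\<close>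

context coprime_bases
begin

text \<open>Of the points \<open>(halton T n, n / N)\<close> the last \<open>k\<close> are replaced by a cluster on the last
  coordinate axis. Their last coordinates \<open>(N - k + n) / (2 * N)\<close> lie in the lower half of the slab
  \<open>[1 - k / N, 1]\<close> that contained the original ones.\<close>

definition last_coord :: "nat \<Rightarrow> nat \<Rightarrow> nat \<Rightarrow> real" where
  "last_coord N k n = (if n < N - k then real n / real N else real (N - k + n) / (2 * real N))"

definition clustered :: "nat \<Rightarrow> nat \<Rightarrow> nat \<Rightarrow> nat \<Rightarrow> nat \<Rightarrow> real" where
  "clustered N k T n = (\<lambda>j\<in>{..<Suc s}.
     if j = s then last_coord N k n else if n < N - k then halton T n j else 0)"

definition clustered_set :: "nat \<Rightarrow> nat \<Rightarrow> nat \<Rightarrow> (nat \<Rightarrow> real) set" where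
  "clustered_set N k T = clustered N k T ` {..<N}"

context
  fixes N k :: nat
  assumes N: "0 < N" and k: "k \<le> N"
begin

text \<open>This alone keeps the points distinct. Over the denominator \<open>2 * N\<close> the
  numerators are \<open>2 * i\<close> before the cluster and at least \<open>2 * (N - k)\<close> in
  it.\<close>

lemma last_coord_strict_mono:
  assumes "m < n"
  shows "last_coord N k m < last_coord N k n"
proof -
  have *: "last_coord N k i = real (if i < N - k then 2 * i else N - k + i) / (2 * real N)" for i
    using N by (simp add: last_coord_def)
  have "(if m < N - k then 2 * m else N - k + m) < (if n < N - k then 2 * n else N - k + n)"
    using assms by arith
  then have "real (if m < N - k then 2 * m else N - k + m) < real (if n < N - k then 2 * n else N - k + n)"
    by (simp only: of_nat_less_iff)
  then show ?thesis
    unfolding * by (rule divide_strict_right_mono) (use N in simp)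
qed

lemma last_coord_bounds:
  assumes "n < N"
  shows "0 \<le> last_coord N k n" "last_coord N k n \<le> 1"
proof -
  have "real (N - k + n) \<le> 2 * real N" using assms by linarith
  then show "last_coord N k n \<le> 1"
    using assms by (simp add: last_coord_def divide_le_eq_1)
qed (simp add: last_coord_def)

lemma inj_clustered: "inj_on (clustered N k T) A"
proof (rule inj_onI)
  fix m n assume "clustered N k T m = clustered N k T n"
  then have "clustered N k T m s = clustered N k T n s" by simp
  then have "last_coord N k m = last_coord N k n" by (simp add: clustered_def)
  then show "m = n" using last_coord_strict_mono by (metis less_irrefl nat_neq_iff)
qed

lemma clustered_set_props:
  shows "finite (clustered_set N k T)" "card (clustered_set N k T) = N"
    "clustered_set N k T \<subseteq> unit_cube (Suc s)"
proof -
  show "finite (clustered_set N k T)" by (simp add: clustered_set_def)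
  show "card (clustered_set N k T) = N"
    unfolding clustered_set_def by (simp add: card_image inj_clustered)
  show "clustered_set N k T \<subseteq> unit_cube (Suc s)"
  proof
    fix q assume "q \<in> clustered_set N k T"
    then obtain n where n: "n < N" "q = clustered N k T n" by (auto simp: clustered_set_def)
    have "q j \<in> {0..1}" if "j < Suc s" for j
      using that n last_coord_bounds[of n] halton_bounds[of T n j]
      by (simp add: clustered_def)
    then show "q \<in> unit_cube (Suc s)"
      by (simp add: unit_cube_def PiE_iff n clustered_def)
  qed
qed

lemma discrepancy_clustered_set:
  assumes "x \<in> unit_cube (Suc s)"
  shows "discrepancy (Suc s) (clustered_set N k T) x =
    (\<Sum>n<N. of_bool (\<forall>j<Suc s. clustered N k T n j < x j)) - real N * (\<Prod>j<Suc s. x j)"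
proof -
  have "(\<Sum>q\<in>clustered_set N k T. \<Prod>j<Suc s. if q j < x j then 1 else 0 :: real) =
      (\<Sum>n<N. \<Prod>j<Suc s. if clustered N k T n j < x j then 1 else 0)"
    unfolding clustered_set_def using inj_clustered by (simp add: sum.reindex del: prod.lessThan_Suc)
  also have "\<dots> = (\<Sum>n<N. of_bool (\<forall>j<Suc s. clustered N k T n j < x j))"
    using prod_of_bool[of "{..<Suc s}"]
    by (intro sum.cong) (simp_all add: of_bool_def Ball_def del: prod.lessThan_Suc)
  finally show ?thesis
    using discrepancy_eq[OF clustered_set_props(1,3) assms] by (simp add: clustered_set_props(2))
qed

text \<open>Only \<open>k\<close> points move. Before and after, their last coordinates are at least
  \<open>1 - k / N\<close>, so only boxes reaching beyond that height are affected, by at most 1 per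
  point.\<close>

lemma abs_discrepancy_clustered_set_le:
  assumes x: "x \<in> unit_cube (Suc s)"
  shows "\<bar>discrepancy (Suc s) (clustered_set N k T) x\<bar>
    \<le> \<bar>halton_count N T x - real N * (\<Prod>j<Suc s. x j)\<bar>
      + real k * of_bool (real (N - k) / real N < x s)"
proof -
  define A where "A = (\<lambda>n. \<forall>j<Suc s. clustered N k T n j < x j)"
  define B where "B = (\<lambda>n. real n / real N < x s \<and> (\<forall>j<s. halton T n j < x j))"
  have diff: "\<bar>of_bool (A n) - of_bool (B n) :: real\<bar>
      \<le> (if n \<in> {N - k..<N} then of_bool (real (N - k) / real N < x s) else 0)" if n: "n < N" for n
  proof (cases "n < N - k")
    case True
    then have "A n \<longleftrightarrow> B n"
      by (auto simp: A_def B_def clustered_def last_coord_def less_Suc_eq)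
    then show ?thesis using True by simp
  next
    case False
    have "real (N - k) \<le> real n" using False by simp
    then have "real (N - k) / real N \<le> last_coord N k n" "real (N - k) / real N \<le> real n / real N"
      using False N by (auto simp: last_coord_def divide_simps)
    then have "\<not> A n \<and> \<not> B n" if "x s \<le> real (N - k) / real N"
      using that by (auto simp: A_def B_def clustered_def intro!: exI[of _ s])
    then show ?thesis using False n by (auto simp: not_less)
  qed
  have "\<bar>(\<Sum>n<N. of_bool (A n)) - halton_count N T x\<bar>
      = \<bar>\<Sum>n<N. of_bool (A n) - of_bool (B n) :: real\<bar>"
    by (simp add: halton_count_def B_def sum_subtractf)
  also have "\<dots> \<le> (\<Sum>n<N. \<bar>of_bool (A n) - of_bool (B n) :: real\<bar>)"
    by (rule sum_abs)
  also have "\<dots> \<le> (\<Sum>n<N. if n \<in> {N - k..<N} then of_bool (real (N - k) / real N < x s) else 0)"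
    using diff by (intro sum_mono) auto
  also have "\<dots> = (\<Sum>n\<in>{N - k..<N}. of_bool (real (N - k) / real N < x s))"
    by (intro sum.mono_neutral_cong_right) auto
  also have "\<dots> = real k * of_bool (real (N - k) / real N < x s)"
    using k by simp
  finally show ?thesis
    unfolding discrepancy_clustered_set[OF x] A_def by linarith
qed

section \<open>Upper bound for the norm with exponent 1\<close>

lemma discrepancy_clustered_set_integrable:
  assumes "0 \<le> p"
  shows "integrable (lborel_pow (Suc s)) (\<lambda>x. indicator (unit_cube (Suc s)) x *
    \<bar>discrepancy (Suc s) (clustered_set N k T) x\<bar> powr p)"
  using integrable_discrepancy_powr[OF clustered_set_props(1,3) assms, of T]
  by (simp add: set_integrable_def)

lemma Lp_norm_clustered_set:
  "Lp_norm (Suc s) p (discrepancy (Suc s) (clustered_set N k T)) =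
    (LINT x|lborel_pow (Suc s). indicator (unit_cube (Suc s)) x *
      \<bar>discrepancy (Suc s) (clustered_set N k T) x\<bar> powr p) powr (1 / p)"
  by (simp add: Lp_norm_def set_lebesgue_integral_def)

text \<open>Average over \<open>T\<close> under the integral. The Halton points contribute at most
  \<open>R\<close>; the moved ones contribute \<open>k\<close> on a slab of measure
  \<open>k / N\<close>, hence at most 1. Some shift does no worse than the mean.\<close>

lemma Lp_norm_1_clustered_set:
  assumes h: "N \<le> 2 ^ h" and k2: "k\<^sup>2 \<le> N"
  shows "\<exists>T. Lp_norm (Suc s) 1 (discrepancy (Suc s) (clustered_set N k T)) \<le> rms + real s + 2"
proof -
  define d where "d = Suc s"
  define U where "U = unit_cube d"
  define D where "D = (\<lambda>T. discrepancy d (clustered_set N k T))"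
  define f where "f = (\<lambda>T x. indicator U x * \<bar>D T x\<bar> powr 1)"
  define slab where "slab = (\<Pi>\<^sub>E j\<in>{..<d}. if j = s then {real (N - k) / real N..1} else {0..1::real})"
  define R where "R = rms + real s + 1"
  interpret product_sigma_finite "\<lambda>_::nat. lborel :: real measure" ..
  have f_int: "integrable (lborel_pow d) (f T)" for T
    unfolding f_def U_def D_def d_def by (rule discrepancy_clustered_set_integrable) simp
  have slab_sets: "slab \<in> sets (lborel_pow d)"
    unfolding slab_def by (rule sets_PiM_I_finite) auto
  have "emeasure (lborel_pow d) slab =
      (\<Prod>j<d. emeasure lborel (if j = s then {real (N - k) / real N..1} else {0..1::real}))"
    unfolding slab_def by (rule emeasure_PiM) auto
  also have "\<dots> = emeasure lborel {real (N - k) / real N..1} *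
      (\<Prod>j<s. emeasure lborel (if j = s then {real (N - k) / real N..1} else {0..1::real}))"
    by (simp add: d_def mult.commute)
  also have "(\<Prod>j<s. emeasure lborel (if j = s then {real (N - k) / real N..1} else {0..1::real})) = 1"
    by (intro prod.neutral) auto
  also have "emeasure lborel {real (N - k) / real N..1} = ennreal (real k / real N)"
  proof -
    have "1 - real (N - k) / real N = real k / real N"
      using N k by (simp add: of_nat_diff diff_divide_distrib)
    moreover have "real (N - k) / real N \<le> 1" using N by simp
    ultimately show ?thesis by simp
  qed
  finally have slab_em: "emeasure (lborel_pow d) slab = ennreal (real k / real N)" by simp
  then have slab_meas: "measure (lborel_pow d) slab = real k / real N"
    by (simp add: measure_def)
  have U_meas: "measure (lborel_pow d) U = 1"
    by (simp add: U_def measure_def emeasure_unit_cube)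
  define g where "g = (\<lambda>x. real Q * R * indicator U x + real Q * real k * indicator slab x)"
  have iU: "integrable (lborel_pow d) (indicat_real U)"
    unfolding U_def by (rule integrable_real_indicator) (auto simp: sets_unit_cube emeasure_unit_cube)
  have iS: "integrable (lborel_pow d) (indicat_real slab)"
    using slab_sets slab_em by (intro integrable_real_indicator) auto
  have g_int: "integrable (lborel_pow d) g"
    unfolding g_def using iU iS by auto
  have fg: "(\<Sum>T<Q. f T x) \<le> g x" for x
  proof (cases "x \<in> U")
    case True
    then have x: "0 \<le> x j \<and> x j \<le> 1" if "j \<le> s" for j
      using unit_cube_coord[of x d j] that by (auto simp: U_def d_def)
    have "x \<in> slab" if "real (N - k) / real N < x s"
      using True that x by (auto simp: slab_def U_def unit_cube_def PiE_iff)
    then have ind: "of_bool (real (N - k) / real N < x s) \<le> indicat_real slab x"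
      by (auto simp: indicator_def)
    have "(\<Sum>T<Q. f T x) = (\<Sum>T<Q. \<bar>D T x\<bar>)" using True by (simp add: f_def)
    also have "\<dots> \<le> (\<Sum>T<Q. \<bar>halton_count N T x - real N * (\<Prod>j<Suc s. x j)\<bar> + real k * indicator slab x)"
    proof (rule sum_mono)
      fix T
      have "\<bar>D T x\<bar> \<le> \<bar>halton_count N T x - real N * (\<Prod>j<Suc s. x j)\<bar>
          + real k * of_bool (real (N - k) / real N < x s)"
        using abs_discrepancy_clustered_set_le[of x T] True by (simp add: D_def U_def d_def)
      also have "\<dots> \<le> \<bar>halton_count N T x - real N * (\<Prod>j<Suc s. x j)\<bar> + real k * indicator slab x"
        using ind by (intro add_left_mono mult_left_mono) auto
      finally show "\<bar>D T x\<bar> \<le> \<bar>halton_count N T x - real N * (\<Prod>j<Suc s. x j)\<bar> + real k * indicator slab x" .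
    qed
    also have "\<dots> \<le> g x"
      using halton_mean_deviation[OF N h x] True
      by (simp add: sum.distrib g_def R_def algebra_simps)
    finally show ?thesis .
  qed (auto simp: f_def g_def)
  have "(\<Sum>T<Q. LINT x|lborel_pow d. f T x) = (LINT x|lborel_pow d. (\<Sum>T<Q. f T x))"
    using f_int by (intro Bochner_Integration.integral_sum[symmetric]) auto
  also have "\<dots> \<le> (LINT x|lborel_pow d. g x)"
    using f_int g_int fg by (intro integral_mono) auto
  also have "\<dots> = real Q * R + real Q * (real k * (real k / real N))"
  proof -
    have "(LINT x|lborel_pow d. indicat_real U x) = 1"
      using U_meas unfolding U_def by (simp add: sets_unit_cube)
    moreover have "(LINT x|lborel_pow d. indicat_real slab x) = real k / real N"
      using slab_meas slab_sets by simp
    ultimately show ?thesis unfolding g_def using iU iS by simp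
  qed
  also have "real k * (real k / real N) \<le> 1"
    using k2 N by (simp add: power2_eq_square field_simps flip: of_nat_mult)
  finally have "(\<Sum>T<Q. LINT x|lborel_pow d. f T x) \<le> real Q * (R + 1)"
    by (simp add: distrib_left mult_left_mono)
  then have "\<exists>T<Q. (LINT x|lborel_pow d. f T x) \<le> R + 1"
  proof (rule contrapos_pp)
    assume "\<not> (\<exists>T<Q. (LINT x|lborel_pow d. f T x) \<le> R + 1)"
    then have "(\<Sum>T<Q. R + 1) < (\<Sum>T<Q. LINT x|lborel_pow d. f T x)"
      using Q_pos by (intro sum_strict_mono) (auto simp: not_le)
    then show "\<not> (\<Sum>T<Q. LINT x|lborel_pow d. f T x) \<le> real Q * (R + 1)" by simp
  qed
  then obtain T where T: "(LINT x|lborel_pow d. f T x) \<le> R + 1" by auto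
  have "0 \<le> (LINT x|lborel_pow d. f T x)"
    by (intro integral_nonneg_AE) (auto simp: f_def)
  then have "Lp_norm d 1 (D T) = (LINT x|lborel_pow d. f T x)"
    unfolding Lp_norm_clustered_set[of 1 T, folded d_def] D_def f_def U_def by simp
  then show ?thesis using T by (auto simp: R_def D_def d_def intro!: exI[of _ T])
qed

section \<open>Lower bound for the norm with exponent 2\<close>

text \<open>No point has its last coordinate in \<open>[1 - l, 1]\<close>, so there the discrepancy
  is affine in it with slope \<open>- V\<close>. Other coordinates in \<open>[1/2, 1]\<close> give
  \<open>V \<ge> N / 2 ^ s\<close>. This works for every \<open>T\<close>, which leaves the shift
  free for the other norm.\<close>

lemma Lp_norm_2_clustered_set:
  "sqrt (real k ^ 3 / (256 * real N * 8 ^ s))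
    \<le> Lp_norm (Suc s) 2 (discrepancy (Suc s) (clustered_set N k T))"
proof -
  define d where "d = Suc s"
  define U where "U = unit_cube d"
  define D where "D = discrepancy d (clustered_set N k T)"
  define f where "f = (\<lambda>x. indicator U x * \<bar>D x\<bar> powr 2)"
  define l where "l = real k / (2 * real N)"
  define X where "X = (\<Pi>\<^sub>E j\<in>{..<s}. {1/2..1::real})"
  \<comment> \<open>The bound for the inner integral with \<open>V\<close> at its least; integrating
    over \<open>X\<close> adds the factor \<open>(1/2) ^ s\<close>.\<close>
  define A where "A = (real N * (1/2) ^ s)\<^sup>2 * l ^ 3 / 32"
  interpret product_sigma_finite "\<lambda>_::nat. lborel :: real measure" ..
  have f_int: "integrable (lborel_pow d) f"
    unfolding f_def U_def D_def d_def by (rule discrepancy_clustered_set_integrable) simp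
  have f_nonneg: "0 \<le> f x" for x by (simp add: f_def)
  have l: "0 \<le> l" "l \<le> 1"
  proof -
    have "real k \<le> 2 * real N" using k by simp
    then show "l \<le> 1" "0 \<le> l" using N by (auto simp: l_def divide_le_eq_1)
  qed
  have inner: "ennreal A \<le> (\<integral>\<^sup>+y. ennreal (f (x(s := y))) \<partial>lborel)" if x: "x \<in> X" for x
  proof -
    define V where "V = real N * (\<Prod>j<s. x j)"
    \<comment> \<open>The count for any \<open>y\<close> above all last coordinates. Clustered
      points always count: their other coordinates are 0 and each \<open>x j\<close> is
      positive.\<close>
    define K :: real where "K = (\<Sum>n<N. of_bool (N - k \<le> n \<or> (\<forall>j<s. halton T n j < x j)))"
    have xj: "1/2 \<le> x j" "x j \<le> 1" if "j < s" for j
      using PiE_mem[OF x[unfolded X_def], of j] that by simp_all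
    have xj0: "0 < x j" if "j < s" for j using xj(1)[OF that] by linarith
    have "(\<Prod>j<s. 1/2) \<le> (\<Prod>j<s. x j)" using xj by (intro prod_mono) auto
    then have V: "real N * (1/2) ^ s \<le> V" unfolding V_def by (intro mult_left_mono) auto
    have V0: "0 \<le> V" by (rule order.trans[OF _ V]) simp
    have "(real N * (1/2) ^ s)\<^sup>2 * l ^ 3 \<le> V\<^sup>2 * l ^ 3"
      using l power_mono[OF V, of 2] by (intro mult_right_mono) simp_all
    then have "A \<le> V\<^sup>2 * l ^ 3 / 32"
      unfolding A_def by (rule divide_right_mono) simp
    then have "ennreal A \<le> ennreal (V\<^sup>2 * l ^ 3 / 32)" by (rule ennreal_leI)
    also have "\<dots> \<le> (\<integral>\<^sup>+y. ennreal ((K - V * y)\<^sup>2) * indicator {1 - l..(1 - l) + l} y \<partial>lborel)"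
      by (rule nn_integral_affine_square_ge[OF V0 l(1)])
    also have "\<dots> \<le> (\<integral>\<^sup>+y. ennreal (f (x(s := y))) \<partial>lborel)"
    proof (intro nn_integral_mono)
      fix y :: real
      show "ennreal ((K - V * y)\<^sup>2) * indicator {1 - l..(1 - l) + l} y \<le> ennreal (f (x(s := y)))"
      proof (cases "y \<in> {1 - l..1}")
        case True
        define z where "z = x(s := y)"
        have "z j \<in> {0..1}" if "j < Suc s" for j
          using that True l xj0 xj by (cases "j = s") (auto simp: z_def less_Suc_eq less_imp_le)
        moreover have "z \<in> extensional {..<Suc s}"
          using x by (auto simp: z_def X_def PiE_iff extensional_def)
        ultimately have z: "z \<in> U"
          by (auto simp: U_def d_def unit_cube_def PiE_iff)
        \<comment> \<open>The numerator of a clustered point over \<open>2 * N\<close> is at most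
          \<open>2 * N - k - 1\<close>, one less than that of \<open>1 - l\<close>.\<close>
        have last: "last_coord N k n < y" if "n < N" for n
        proof -
          have "1 - l = (2 * real N - real k) / (2 * real N)"
            using N by (simp add: l_def diff_divide_distrib)
          moreover have "last_coord N k n < (2 * real N - real k) / (2 * real N)"
          proof (cases "n < N - k")
            case True
            then have "2 * real n < 2 * real N - real k" by linarith
            then show ?thesis using True N by (simp add: last_coord_def field_simps)
          next
            case False
            have "real (N - k + n) < 2 * real N - real k" using that k by linarith
            then show ?thesis using False N by (simp add: last_coord_def divide_strict_right_mono)
          qed
          ultimately show ?thesis using \<open>y \<in> {1 - l..1}\<close> by simp
        qed
        have "(\<forall>j<Suc s. clustered N k T n j < z j) \<longleftrightarrow>
            N - k \<le> n \<or> (\<forall>j<s. halton T n j < x j)" if "n < N" for n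
          using last[OF that] xj0
          by (cases "n < N - k") (auto simp: clustered_def z_def less_Suc_eq not_less)
        then have "(\<Sum>n<N. of_bool (\<forall>j<Suc s. clustered N k T n j < z j)) = K"
          unfolding K_def by (intro sum.cong) auto
        moreover have "(\<Prod>j<Suc s. z j) = (\<Prod>j<s. x j) * y"
          by (simp add: z_def)
        ultimately have "D z = K - V * y"
          using discrepancy_clustered_set[of z T] z
          by (simp add: D_def d_def U_def V_def del: prod.lessThan_Suc)
        then have "f z = (K - V * y)\<^sup>2"
          using z by (simp add: f_def)
        then show ?thesis using True by (simp add: z_def)
      qed simp
    qed
    finally show ?thesis .
  qed
  have X_em: "emeasure (lborel_pow s) X = ennreal ((1/2) ^ s)"
  proof -
    have "emeasure (lborel_pow s) X = (\<Prod>j<s. emeasure lborel {1/2..1::real})"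
      unfolding X_def by (rule emeasure_PiM) auto
    also have "\<dots> = (\<Prod>j<s. ennreal (1/2))"
      by (intro prod.cong) simp_all
    finally show ?thesis by (simp add: ennreal_power del: ennreal_half)
  qed
  have X_sets: "X \<in> sets (lborel_pow s)"
    unfolding X_def by (rule sets_PiM_I_finite) auto
  have A0: "0 \<le> A" using l by (simp add: A_def)
  have "ennreal (A * (1/2) ^ s) = (\<integral>\<^sup>+x. ennreal A * indicator X x \<partial>lborel_pow s)"
    using X_sets A0 by (simp add: nn_integral_cmult_indicator X_em ennreal_mult)
  also have "\<dots> \<le> (\<integral>\<^sup>+x. (\<integral>\<^sup>+y. ennreal (f (x(s := y))) \<partial>lborel) \<partial>lborel_pow s)"
    using inner by (intro nn_integral_mono) (auto simp: indicator_def)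
  also have "\<dots> = (\<integral>\<^sup>+x. ennreal (f x) \<partial>lborel_pow d)"
    using f_int unfolding d_def lessThan_Suc
    by (intro product_nn_integral_insert[symmetric]) auto
  also have "\<dots> = ennreal (LINT x|lborel_pow d. f x)"
    using f_int f_nonneg by (intro nn_integral_eq_integral) auto
  finally have "A * (1/2) ^ s \<le> (LINT x|lborel_pow d. f x)"
    using f_nonneg by (subst (asm) ennreal_le_iff) (auto intro: integral_nonneg_AE)
  moreover have "A * (1/2) ^ s = real k ^ 3 / (256 * real N * 8 ^ s)"
  proof -
    define w where "w = (1/2 :: real) ^ s"
    have "w ^ 3 = ((1/2) ^ 3) ^ s"
      unfolding w_def by (simp only: power_mult[symmetric] mult.commute)
    then have w: "w ^ 3 = 1 / 8 ^ s" by (simp add: power_divide)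
    have "A * w = real N ^ 2 * l ^ 3 * w ^ 3 / 32"
      by (simp add: A_def w_def[symmetric] power2_eq_square power3_eq_cube)
    also have "real N ^ 2 * l ^ 3 = real k ^ 3 / (8 * real N)"
      using N by (simp add: l_def power2_eq_square power3_eq_cube)
    finally show ?thesis by (simp add: w flip: w_def)
  qed
  moreover have "Lp_norm d 2 D = sqrt (LINT x|lborel_pow d. f x)"
    unfolding Lp_norm_clustered_set[of 2 T, folded d_def] D_def f_def U_def
    by (intro powr_half_sqrt integral_nonneg_AE) auto
  ultimately show ?thesis by (simp add: D_def d_def)
qed

end

end

section \<open>Choice of the constants and parameters\<close>

theorem theorem1p8:
  "\<forall>d::nat. d \<ge> 2 \<longrightarrow>
    (\<exists>C c :: real. C > 0 \<and> c > 0 \<and>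
      (\<forall>N::nat. N \<ge> 2 \<longrightarrow>
        (\<exists>P :: (nat \<Rightarrow> real) set. P \<subseteq> unit_cube d \<and> finite P \<and> card P = N \<and>
          Lp_norm d 1 (discrepancy d P) \<le> C * ln (real N) powr ((real d - 1) / 2) \<and>
          Lp_norm d 2 (discrepancy d P) \<ge> c * real N powr (1 / 4))))"
proof (intro allI impI)
  fix d :: nat assume "d \<ge> 2"
  then obtain s where d: "d = Suc s" by (cases d) auto
  \<comment> \<open>The bases are fixed before \<open>N\<close>, so \<open>C\<close> and
    \<open>c\<close> depend only on \<open>d\<close>.\<close>
  obtain b :: "nat \<Rightarrow> nat" where b: "\<And>i. 1 < b i" "\<And>i j. i \<noteq> j \<Longrightarrow> coprime (b i) (b j)"
    using coprime_bases_exist by blast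
  define P where "P = (\<Prod>j<s. real (b j))"
  \<comment> \<open>The 6 comes from \<open>h + 1 \<le> 6 * ln N\<close>. In \<open>c\<close>, 2048
    is 256 times the 8 lost by cubing \<open>k \<ge> sqrt N / 2\<close>.\<close>
  define C where "C = (P + real s + 2) * 6 powr (real s / 2)"
  define c where "c = sqrt (1 / (2048 * 8 ^ s) :: real)"
  have P0: "0 \<le> P" unfolding P_def by (intro prod_nonneg) auto
  show "\<exists>C c :: real. C > 0 \<and> c > 0 \<and>
      (\<forall>N::nat. N \<ge> 2 \<longrightarrow>
        (\<exists>P :: (nat \<Rightarrow> real) set. P \<subseteq> unit_cube d \<and> finite P \<and> card P = N \<and>
          Lp_norm d 1 (discrepancy d P) \<le> C * ln (real N) powr ((real d - 1) / 2) \<and>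
          Lp_norm d 2 (discrepancy d P) \<ge> c * real N powr (1 / 4)))"
  proof (rule exI[of _ C], rule exI[of _ c], intro conjI allI impI)
    show "0 < C" "0 < c" using P0 by (auto simp: C_def c_def)
  next
    fix N :: nat assume N2: "2 \<le> N"
    \<comment> \<open>This size serves both norms: \<open>k ^ 2 \<le> N\<close> bounds the cost of
      moving points, and \<open>k ^ 3 / N\<close> is of order \<open>sqrt N\<close>.\<close>
    define k where "k = nat \<lfloor>sqrt (real N)\<rfloor>"
    define h where "h = nat \<lceil>log 2 (real N)\<rceil>"
    interpret coprime_bases s h b using b by unfold_locales
    have N: "0 < N" using N2 by simp
    have sqrt_ge: "1 \<le> sqrt (real N)" using N2 by simp
    have k_le: "real k \<le> sqrt (real N)" unfolding k_def using sqrt_ge by simp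
    have k_ge: "sqrt (real N) / 2 \<le> real k"
    proof -
      have "1 \<le> \<lfloor>sqrt (real N)\<rfloor>" using sqrt_ge by (simp add: le_floor_iff)
      then have "real k = of_int \<lfloor>sqrt (real N)\<rfloor>" "1 \<le> real k" by (auto simp: k_def)
      moreover have "sqrt (real N) < of_int \<lfloor>sqrt (real N)\<rfloor> + 1" by linarith
      ultimately show ?thesis by linarith
    qed
    have k2: "k\<^sup>2 \<le> N"
    proof -
      have "(real k)\<^sup>2 \<le> (sqrt (real N))\<^sup>2" using k_le by (intro power_mono) auto
      then have "real (k\<^sup>2) \<le> real N" by simp
      then show ?thesis by (simp only: of_nat_le_iff)
    qed
    have kN: "k \<le> N" using k2 by (rule power2_nat_le_imp_le)
    have lnN: "1 / 2 \<le> ln (real N)"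
    proof -
      have "2 / 3 \<le> ln (2::real)" by (rule ln2_ge_two_thirds)
      also have "\<dots> \<le> ln (real N)" using N2 by simp
      finally show ?thesis by simp
    qed
    have h: "N \<le> 2 ^ h"
    proof -
      have "log 2 (real N) \<le> real h" unfolding h_def by linarith
      then have "real N \<le> 2 powr real h" using N by (simp add: log_le_iff)
      then have "real N \<le> real (2 ^ h)" by (simp add: powr_realpow)
      then show ?thesis by (simp only: of_nat_le_iff)
    qed
    have h_le: "real (Suc h) \<le> 6 * ln (real N)"
    proof -
      have "log 2 (real N) = ln (real N) / ln 2" by (simp add: log_def)
      also have "\<dots> \<le> ln (real N) / (2/3)"
        using lnN ln2_ge_two_thirds by (intro divide_left_mono) auto
      finally have "log 2 (real N) \<le> 3/2 * ln (real N)" by simp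
      moreover have "0 \<le> log 2 (real N)" using N2 by simp
      ultimately have "real (Suc h) \<le> 3/2 * ln (real N) + 2" unfolding h_def by linarith
      then show ?thesis using lnN by linarith
    qed
    define G where "G = (6 * ln (real N)) powr (real s / 2)"
    \<comment> \<open>This absorbs the constant \<open>s + 2\<close> into the power of the
      logarithm.\<close>
    have G1: "1 \<le> G" unfolding G_def using lnN by (intro ge_one_powr_ge_zero) auto
    have "sqrt (real (Suc h) ^ s) = real (Suc h) powr (real s / 2)"
      by (simp add: powr_half_sqrt[symmetric] powr_powr flip: powr_realpow)
    also have "\<dots> \<le> G" unfolding G_def using h_le by (intro powr_mono2) auto
    finally have rms: "rms \<le> G * P" unfolding rms_def P_def[symmetric] using P0 by (intro mult_right_mono)
    obtain T where T: "Lp_norm (Suc s) 1 (discrepancy (Suc s) (clustered_set N k T)) \<le> rms + real s + 2"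
      using Lp_norm_1_clustered_set[OF N kN h k2] by blast
    have "rms + real s + 2 \<le> G * P + G * real s + G * 2"
      using rms G1 by (intro add_mono) (auto simp: mult_le_cancel_right1)
    also have "\<dots> = C * ln (real N) powr ((real d - 1) / 2)"
      using lnN by (simp add: C_def G_def d powr_mult algebra_simps)
    finally have L1: "Lp_norm d 1 (discrepancy d (clustered_set N k T))
        \<le> C * ln (real N) powr ((real d - 1) / 2)"
      using T by (simp add: d)
    have "c * real N powr (1/4) = sqrt (sqrt (real N) / (2048 * 8 ^ s))"
    proof -
      have "real N powr (1/4) = sqrt (sqrt (real N))"
        by (simp add: powr_half_sqrt[symmetric] powr_powr)
      then show ?thesis by (simp add: c_def real_sqrt_divide)
    qed
    also have "\<dots> \<le> sqrt (real k ^ 3 / (256 * real N * 8 ^ s))"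
    proof -
      have "sqrt (real N) ^ 3 / 8 = (sqrt (real N) / 2) ^ 3" by (simp add: power_divide)
      also have "\<dots> \<le> real k ^ 3" using k_ge by (intro power_mono) auto
      finally have "sqrt (real N) * real N / 8 \<le> real k ^ 3"
        by (simp add: power3_eq_cube mult.commute)
      then have "sqrt (real N) * real N / 8 / (256 * real N * 8 ^ s) \<le> real k ^ 3 / (256 * real N * 8 ^ s)"
        by (intro divide_right_mono) auto
      then show ?thesis using N by simp
    qed
    also have "\<dots> \<le> Lp_norm (Suc s) 2 (discrepancy (Suc s) (clustered_set N k T))"
      by (rule Lp_norm_2_clustered_set[OF N kN])
    finally have L2: "c * real N powr (1/4) \<le> Lp_norm d 2 (discrepancy d (clustered_set N k T))"
      by (simp add: d)
    show "\<exists>P. P \<subseteq> unit_cube d \<and> finite P \<and> card P = N \<and>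
        Lp_norm d 1 (discrepancy d P) \<le> C * ln (real N) powr ((real d - 1) / 2) \<and>
        Lp_norm d 2 (discrepancy d P) \<ge> c * real N powr (1 / 4)"
      using clustered_set_props[OF N kN, of T] L1 L2
      by (intro exI[of _ "clustered_set N k T"]) (auto simp: d)
  qed
qed

end
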